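(* Let $G$ be a finite abelian group of order $n$, let $f : G \to \mathbb{C}$ be a function with $|\mathrm{supp}(f)| = k \neq 0$, let $d_1$ be the largest divisor of $n$ with $d_1 \leq k$, and let $d_2$ be the smallest divisor of $n$ with $d_2 \geq k$. Then $$|\mathrm{supp}(\widehat{f})| \geq \frac{n}{d_1 d_2}\,(d_1 + d_2 - k).$$
   Context: For a finite abelian group $G$, written additively, $\widehat{G}$ denotes its character group, i.e. the group of homomorphisms $\chi : G \to \mathbb{C}^{*}$. For $f : G \to \mathbb{C}$, the Fourier transform $\widehat{f} : \widehat{G} \to \mathbb{C}$ is defined by $\widehat{f}(\chi) = \sum_{x \in G} f(x)\chi(-x)$. The support of a complex valued function is the set of points where it is nonzero: $\mathrm{supp}(f) = \{x \in G : f(x) \neq 0\}$ and $\mathrm{supp}(\widehat{f}) = \{\chi \in \widehat{G} : \widehat{f}(\chi) \neq 0\}$. Divisors are positive divisors. If $k$ itself divides $n$, then $d_1 = d_2 = k$. *)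

theory Defs
  imports Complex_Main "HOL-Algebra.Coset"
begin

text \<open>HOL-Algebra writes groups multiplicatively, so \<open>-x\<close> in the
  additive group becomes \<open>inv\<^bsub>G\<^esub> x\<close>.\<close>

definition complex_mult_group :: "complex monoid"
  where "complex_mult_group = \<lparr>carrier = - {0}, mult = (*), one = 1\<rparr>"

text \<open>Characters are required to be extensional (fixed to \<open>undefined\<close> off the
  carrier): otherwise one homomorphism on \<open>carrier G\<close> would be represented by several
  HOL functions, and cardinalities of sets of characters would be wrong.\<close>

definition character_group :: "('a, 'b) monoid_scheme \<Rightarrow> ('a \<Rightarrow> complex) monoid"
  where "character_group G =
    \<lparr>carrier = hom G complex_mult_group \<inter> extensional (carrier G),
     mult = (\<lambda>\<chi> \<psi>. \<lambda>x\<in>carrier G. \<chi> x * \<psi> x),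
     one = (\<lambda>x\<in>carrier G. 1)\<rparr>"

definition fourier :: "('a, 'b) monoid_scheme \<Rightarrow> ('a \<Rightarrow> complex) \<Rightarrow> ('a \<Rightarrow> complex) \<Rightarrow> complex"
  where "fourier G f \<chi> = (\<Sum>x\<in>carrier G. f x * \<chi> (inv\<^bsub>G\<^esub> x))"

definition supp :: "('a, 'b) monoid_scheme \<Rightarrow> ('a \<Rightarrow> complex) \<Rightarrow> 'a set"
  where "supp G f = {x \<in> carrier G. f x \<noteq> 0}"

end

theory Submission
  imports "HOL-Number_Theory.Cong" "Jordan_Normal_Form.Char_Poly"
    "HOL-Algebra.Multiplicative_Group" Defs
begin

text \<open>
  Choose a subgroup \<open>H\<close> of prime index \<open>q\<close>. Summing \<open>f\<close> over the cosets of \<open>H\<close> against a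
  character \<open>\<psi>\<close> of \<open>H\<close> gives a function on \<open>q\<close> points, and the values of the Fourier transform
  of \<open>f\<close> at the \<open>q\<close> extensions of \<open>\<psi>\<close> form its Fourier transform over the integers modulo \<open>q\<close>.
  If \<open>f\<close> meets \<open>t\<close> cosets and at least \<open>s\<close> points of each of them, induction on \<open>H\<close> and the
  inequality of Tao for the prime \<open>q\<close> bound the support of the transform below by
  \<open>u(|H|, s) * (q + 1 - t)\<close>, where \<open>u(n, k)\<close> is the claimed bound. Since \<open>s * t \<le> k\<close>, it remains
  to see that \<open>u\<close>, the piecewise linear interpolation of \<open>n / k\<close> at the divisors of \<open>n\<close>, is
  decreasing and satisfies \<open>u(q * m, s * t) \<le> u(m, s) * (q + 1 - t)\<close>.

  Tao's inequality amounts to Chebotarev's theorem that no minor of the Fourier matrix of prime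
  order vanishes. Newton interpolation reduces a vanishing minor to the vanishing at a root of
  unity of an integer polynomial determinant, whose value at \<open>1\<close> is a determinant of binomial
  coefficients and would have to be divisible by the prime.
\<close>

section \<open>Integer polynomials at roots of unity of prime order\<close>

text \<open>This is the ring usually written Z[w].\<close>

abbreviation int_poly_ring :: "'a::comm_ring_1 \<Rightarrow> 'a set"
  where "int_poly_ring w \<equiv> range (\<lambda>Q. poly (of_int_poly Q) w)"

lemma int_poly_ring_of_int [simp]: "of_int m \<in> int_poly_ring w"
  by (rule range_eqI[of _ _ "[:m:]"]) (simp add: of_int_hom.map_poly_pCons_hom)

lemma int_poly_ring_self [simp]: "w \<in> int_poly_ring w"
  by (rule range_eqI[of _ _ "[:0, 1:]"]) simp

lemma int_poly_ring_add: "x \<in> int_poly_ring w \<Longrightarrow> y \<in> int_poly_ring w \<Longrightarrow> x + y \<in> int_poly_ring w"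
proof (clarify)
  fix P Q :: "int poly"
  show "poly (of_int_poly P) w + poly (of_int_poly Q) w \<in> int_poly_ring w"
    by (rule range_eqI[of _ _ "P + Q"]) (simp add: of_int_poly_hom.hom_add)
qed

lemma int_poly_ring_mult: "x \<in> int_poly_ring w \<Longrightarrow> y \<in> int_poly_ring w \<Longrightarrow> x * y \<in> int_poly_ring w"
proof (clarify)
  fix P Q :: "int poly"
  show "poly (of_int_poly P) w * poly (of_int_poly Q) w \<in> int_poly_ring w"
    by (rule range_eqI[of _ _ "P * Q"]) (simp add: of_int_poly_hom.hom_mult)
qed

lemma int_poly_ring_power: "x \<in> int_poly_ring w \<Longrightarrow> x ^ n \<in> int_poly_ring w"
  using int_poly_ring_of_int[of 1 w] by (induction n) (auto intro: int_poly_ring_mult simp del: int_poly_ring_of_int)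

lemma int_poly_ring_sum: "(\<And>i. i \<in> I \<Longrightarrow> x i \<in> int_poly_ring w) \<Longrightarrow> sum x I \<in> int_poly_ring w"
  using int_poly_ring_of_int[of 0 w]
  by (induction I rule: infinite_finite_induct)
    (auto intro: int_poly_ring_add simp del: int_poly_ring_of_int)

text \<open>Horner's rule builds up the polynomial, and multiplication by \<open>w\<close> merely
  shifts the coefficients cyclically because \<open>w ^ p = 1\<close>.\<close>

lemma int_poly_ring_root_of_unity:
  fixes w :: "'a::comm_ring_1"
  assumes "w ^ p = 1" and "p > 0"
  shows "\<exists>r. poly (of_int_poly Q) w = (\<Sum>j<p. of_int (r j) * w ^ j)"
proof (induction Q)
  case 0
  show ?case by (intro exI[of _ "\<lambda>_. 0"]) simp
next
  case (pCons a Q)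
  then obtain r where r: "poly (of_int_poly Q) w = (\<Sum>j<p. of_int (r j) * w ^ j)" by blast
  obtain q where q: "p = Suc q" using assms(2) by (cases p) auto
  have wq: "w * w ^ q = 1" using assms(1) q by simp
  \<comment> \<open>The top coefficient \<open>r q\<close> wraps around to the constant term, where
    \<open>a\<close> is added.\<close>
  let ?r = "\<lambda>j. case j of 0 \<Rightarrow> a + r q | Suc i \<Rightarrow> r i"
  have "(\<Sum>j<p. of_int (?r j) * w ^ j) = of_int (a + r q) + (\<Sum>j<q. of_int (r j) * w ^ Suc j)"
    unfolding q sum.lessThan_Suc_shift by simp
  moreover have "w * (\<Sum>j<p. of_int (r j) * w ^ j) = (\<Sum>j<q. of_int (r j) * w ^ Suc j) + of_int (r q)"
    using wq by (simp add: q sum_distrib_left distrib_left mult.left_commute[of w])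
  ultimately have "poly (of_int_poly (pCons a Q)) w = (\<Sum>j<p. of_int (?r j) * w ^ j)"
    by (simp add: r of_int_hom.map_poly_pCons_hom)
  then show ?case by (rule exI[of _ ?r])
qed

lemma det_cong:
  fixes A B :: "int mat"
  assumes "A \<in> carrier_mat n n" and "B \<in> carrier_mat n n"
    and "\<And>i j. i < n \<Longrightarrow> j < n \<Longrightarrow> [A $$ (i, j) = B $$ (i, j)] (mod m)"
  shows "[det A = det B] (mod m)"
  unfolding det_def'[OF assms(1)] det_def'[OF assms(2)]
proof (intro cong_sum cong_mult cong_refl cong_prod)
  fix s i assume "s \<in> {s. s permutes {0..<n}}" "i \<in> {0..<n}"
  then show "[A $$ (i, s i) = B $$ (i, s i)] (mod m)"
    using permutes_in_image[of s "{0..<n}" i] by (intro assms(3)) auto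
qed

text \<open>If \<open>1 / p\<close> were integral, multiplication by it would be given by an integer matrix \<open>R\<close> on
  the span of the powers of \<open>w\<close>, and \<open>1 - p R\<close> would be singular although its determinant is
  \<open>1\<close> modulo \<open>p\<close>.\<close>

lemma inverse_not_in_int_poly_ring:
  fixes w :: complex
  assumes w: "w ^ p = 1" and p: "p > 1"
  shows "1 / of_nat p \<notin> int_poly_ring w"
proof
  assume inv: "1 / of_nat p \<in> int_poly_ring w"
  have "\<forall>i. \<exists>r. w ^ i * (1 / of_nat p) = (\<Sum>j<p. of_int (r j) * w ^ j)"
  proof
    fix i
    have "w ^ i * (1 / of_nat p) \<in> int_poly_ring w"
      by (intro int_poly_ring_mult int_poly_ring_power int_poly_ring_self inv)
    then obtain Q where "w ^ i * (1 / of_nat p) = poly (of_int_poly Q) w" by blast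
    then show "\<exists>r. w ^ i * (1 / of_nat p) = (\<Sum>j<p. of_int (r j) * w ^ j)"
      using int_poly_ring_root_of_unity[OF w, of Q] p by simp
  qed
  then obtain R where R: "\<And>i. w ^ i * (1 / of_nat p) = (\<Sum>j<p. of_int (R i j) * w ^ j)"
    by metis
  define A :: "int mat" where "A = mat p p (\<lambda>(i, j). (if i = j then 1 else 0) - int p * R i j)"
  have A: "A \<in> carrier_mat p p" by (simp add: A_def)
  have "[det A = det (1\<^sub>m p)] (mod int p)"
    by (rule det_cong[OF A]) (auto simp: A_def cong_iff_dvd_diff)
  then have "[det A = 1] (mod int p)" by simp
  moreover have "det A = 0"
  proof -
    let ?A = "map_mat of_int A :: complex mat" and ?v = "vec p (\<lambda>j. w ^ j)"
    have "?A *\<^sub>v ?v = 0\<^sub>v p"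
    proof (rule eq_vecI)
      fix i assume i: "i < dim_vec (0\<^sub>v p :: complex vec)"
      then have "(?A *\<^sub>v ?v) $ i
          = (\<Sum>j<p. (if i = j then w ^ j else 0) - of_nat p * (of_int (R i j) * w ^ j))"
        by (auto simp: A_def scalar_prod_def lessThan_atLeast0 algebra_simps intro!: sum.cong)
      also have "\<dots> = w ^ i - of_nat p * (\<Sum>j<p. of_int (R i j) * w ^ j)"
        using i by (simp add: sum_subtractf sum_distrib_left)
      also have "\<dots> = 0" using p by (simp flip: R)
      finally show "(?A *\<^sub>v ?v) $ i = 0\<^sub>v p $ i" using i by simp
    qed (simp add: A_def)
    moreover have "?v \<noteq> 0\<^sub>v p"
    proof
      assume "?v = 0\<^sub>v p"
      then have "?v $ 0 = 0\<^sub>v p $ 0" by simp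
      then show False using p by simp
    qed
    ultimately have "det ?A = 0"
      using A by (intro iffD2[OF det_0_iff_vec_prod_zero[of ?A p]] exI[of _ ?v]) auto
    then show ?thesis by simp
  qed
  ultimately show False using p by (simp add: cong_iff_dvd_diff)
qed

text \<open>In the binomial expansion the inner coefficients are multiples of \<open>p\<close>. The
  two outer terms add up to \<open>1 + (-1) ^ p\<close>, which is 0 for odd \<open>p\<close> and 2
  for \<open>p = 2\<close>.\<close>

lemma one_minus_root_of_unity_power:
  fixes w :: complex
  assumes w: "w ^ p = 1" and p: "prime p"
  shows "\<exists>r \<in> int_poly_ring w. (1 - w) ^ p = of_nat p * r"
proof -
  have "\<exists>c. \<forall>k\<in>{1..<p}. p choose k = p * c k"
    by (intro bchoice ballI) (use p dvd_choose_prime in \<open>auto elim!: dvdE\<close>)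
  then obtain c where c: "\<And>k. k \<in> {1..<p} \<Longrightarrow> p choose k = p * c k" by blast
  have p0: "p > 0" using p prime_gt_0_nat by blast
  obtain e :: int where e: "1 + (-1) ^ p = int p * e"
  proof (cases "p = 2")
    case False
    then have "odd p" using p primes_dvd_imp_eq two_is_prime_nat by blast
    then show ?thesis using that[of 0] by simp
  qed (use that[of 1] in simp)
  have split: "{..p} = insert 0 (insert p {1..<p})" using p0 by auto
  have "(1 - w) ^ p = (-w + 1) ^ p" by simp
  also have "\<dots> = (\<Sum>k\<le>p. of_nat (p choose k) * (-w) ^ k)"
    unfolding binomial_ring by simp
  also have "\<dots> = 1 + (-1) ^ p * w ^ p + (\<Sum>k\<in>{1..<p}. of_nat (p choose k) * (-w) ^ k)"
    unfolding split using p0 by (simp flip: power_mult_distrib)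
  also have "1 + (-1) ^ p * w ^ p = (of_int (1 + (-1) ^ p) :: complex)" by (simp add: w)
  also have "\<dots> = of_nat p * of_int e" by (simp only: e of_int_mult of_int_of_nat_eq)
  also have "(\<Sum>k\<in>{1..<p}. of_nat (p choose k) * (-w) ^ k)
      = of_nat p * (\<Sum>k\<in>{1..<p}. of_nat (c k) * (-w) ^ k)"
    unfolding sum_distrib_left by (rule sum.cong) (auto simp: c)
  finally have eq: "(1 - w) ^ p = of_nat p * (of_int e + (\<Sum>k\<in>{1..<p}. of_nat (c k) * (-w) ^ k))"
    by (simp add: distrib_left)
  have "-w \<in> int_poly_ring w"
    using int_poly_ring_mult[OF int_poly_ring_of_int[of "-1"] int_poly_ring_self, of w] by simp
  moreover have "of_nat m \<in> int_poly_ring w" for m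
    using int_poly_ring_of_int[of "int m" w] by (simp del: int_poly_ring_of_int)
  ultimately have "of_int e + (\<Sum>k\<in>{1..<p}. of_nat (c k) * (-w) ^ k) \<in> int_poly_ring w"
    by (intro int_poly_ring_add int_poly_ring_sum int_poly_ring_mult int_poly_ring_power) simp_all
  with eq show ?thesis by blast
qed

text \<open>Dividing \<open>Q\<close> by X - 1 shows that its value \<open>m\<close> at 1 is a
  multiple of \<open>1 - w\<close> in Z[w], so \<open>m ^ p\<close> is a multiple of
  \<open>p\<close> there. If \<open>m\<close> were prime to \<open>p\<close>, a Bezout relation
  would make \<open>p\<close> invertible in Z[w].\<close>

lemma prime_dvd_poly_1:
  fixes w :: complex
  assumes w: "w ^ p = 1" and p: "prime p" and Q: "poly (of_int_poly Q) w = 0"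
  shows "int p dvd poly Q 1"
proof (rule ccontr)
  define m where "m = poly Q 1"
  assume "\<not> int p dvd poly Q 1"
  then have "coprime (int p) (m ^ p)"
    using p by (simp add: m_def prime_imp_coprime)
  then obtain s t where st: "s * int p + t * m ^ p = 1"
    using bezout_int[of "int p" "m ^ p"] by (metis coprime_iff_gcd_eq_1)
  have "poly (Q - [:m:]) 1 = 0" by (simp add: m_def)
  then have "[:-1, 1:] dvd Q - [:m:]" unfolding poly_eq_0_iff_dvd by simp
  then obtain T where T: "Q - [:m:] = [:-1, 1:] * T" unfolding dvd_def by blast
  have "Q = [:m:] + [:-1, 1:] * T" unfolding T[symmetric] by simp
  then have "poly (of_int_poly Q) w = poly (of_int_poly ([:m:] + [:-1, 1:] * T)) w" by simp
  also have "\<dots> = of_int m + (w - 1) * poly (of_int_poly T) w"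
    by (simp only: of_int_poly_hom.hom_add of_int_poly_hom.hom_mult)
      (simp add: of_int_hom.map_poly_pCons_hom algebra_simps)
  finally have m: "of_int m = (1 - w) * poly (of_int_poly T) w" using Q by (simp add: algebra_simps)
  obtain r where r: "r \<in> int_poly_ring w" "(1 - w) ^ p = of_nat p * r"
    using one_minus_root_of_unity_power[OF w p] by blast
  \<comment> \<open>The Bezout relation divided by \<open>p\<close>, with \<open>(1 - w) ^ p\<close>
    replaced by \<open>p * r\<close>.\<close>
  let ?u = "of_int s + of_int t * (r * poly (of_int_poly T) w ^ p)"
  have "of_nat p * ?u = of_int s * of_nat p + of_int t * ((1 - w) * poly (of_int_poly T) w) ^ p"
    by (simp only: power_mult_distrib r(2) distrib_left mult_ac)
  also have "\<dots> = of_int (s * int p + t * m ^ p)" unfolding m[symmetric] by simp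
  finally have "of_nat p * ?u = 1" unfolding st by simp
  then have "?u = 1 / of_nat p" using prime_gt_0_nat[OF p] by (simp only: eq_divide_eq mult.commute) simp
  moreover have "?u \<in> int_poly_ring w"
    by (intro int_poly_ring_add int_poly_ring_mult int_poly_ring_power r rangeI int_poly_ring_of_int)
  ultimately show False
    using inverse_not_in_int_poly_ring[OF w] prime_gt_1_nat[OF p] by simp
qed

section \<open>Minors of the Fourier matrix of prime order\<close>

text \<open>\<open>newton x c a y\<close> is the divided difference of \<open>X ^ a\<close> at the nodes \<open>x 0, \<dots>, x (c - 1), y\<close>,
  that is, the complete homogeneous symmetric polynomial of degree \<open>a - c\<close> in them.\<close>

fun newton :: "(nat \<Rightarrow> 'a::comm_ring_1) \<Rightarrow> nat \<Rightarrow> nat \<Rightarrow> 'a \<Rightarrow> 'a" where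
  "newton x 0 a y = y ^ a"
| "newton x (Suc c) 0 y = 0"
| "newton x (Suc c) (Suc a) y = y * newton x (Suc c) a y + newton x c a (x c)"

text \<open>The recursion of \<open>newton\<close> avoids division and so makes sense over integer
  polynomials; this identity recovers the defining property of divided differences.\<close>

lemma newton_Suc_divided_difference:
  "(y - x c) * newton x (Suc c) a y = newton x c a y - newton x c a (x c)"
proof (induction a)
  case 0
  show ?case by (cases c) simp_all
next
  case (Suc a)
  have "(y - x c) * newton x (Suc c) (Suc a) y
      = y * ((y - x c) * newton x (Suc c) a y) + (y - x c) * newton x c a (x c)"
    by (simp add: algebra_simps)
  also have "\<dots> = y * newton x c a y - x c * newton x c a (x c)"
    unfolding Suc by (simp add: algebra_simps)
  also have "\<dots> = newton x c (Suc a) y - newton x c (Suc a) (x c)"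
    by (cases c) simp_all
  finally show ?case .
qed

text \<open>With all nodes equal to 1 the recursion is Pascal's rule.\<close>

lemma newton_one: "newton (\<lambda>_. 1) c a 1 = of_nat (a choose c)"
  by (induction "\<lambda>_::nat. 1::'a" c a "1::'a" rule: newton.induct) (simp_all add: add.commute)

lemma (in comm_ring_hom) hom_newton: "hom (newton x c a y) = newton (\<lambda>i. hom (x i)) c a (hom y)"
  by (induction x c a y rule: newton.induct) (simp_all add: hom_distribs)

text \<open>Subtracting the sums at \<open>x d\<close> and \<open>x c\<close> raises the order of
  the divided difference by one, up to the factor \<open>x d - x c\<close>. It can be cancelled,
  since \<open>c < d\<close> at that step.\<close>

lemma sum_newton_eq_0:
  fixes x :: "nat \<Rightarrow> 'a::idom"
  assumes inj: "inj_on x {..<k}" and zero: "\<And>c. c < k \<Longrightarrow> (\<Sum>i\<in>I. f i * x c ^ a i) = 0"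
  shows "c \<le> d \<Longrightarrow> d < k \<Longrightarrow> (\<Sum>i\<in>I. f i * newton x c (a i) (x d)) = 0"
proof (induction c arbitrary: d)
  case 0
  then show ?case by (simp add: zero)
next
  case (Suc c)
  have "(x d - x c) * (\<Sum>i\<in>I. f i * newton x (Suc c) (a i) (x d))
      = (\<Sum>i\<in>I. f i * ((x d - x c) * newton x (Suc c) (a i) (x d)))"
    by (simp add: sum_distrib_left mult.left_commute)
  also have "\<dots> = (\<Sum>i\<in>I. f i * newton x c (a i) (x d)) - (\<Sum>i\<in>I. f i * newton x c (a i) (x c))"
    by (simp only: newton_Suc_divided_difference right_diff_distrib sum_subtractf)
  also have "\<dots> = 0" using Suc by simp
  finally show ?case using inj_onD[OF inj, of d c] Suc.prems by auto
qed

text \<open>Multiplying \<open>x choose c\<close> by a linear factor gives an integer combination of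
  \<open>x choose c\<close> and \<open>x choose Suc c\<close>.\<close>

lemma prod_diff_binomial_expansion:
  assumes "finite J"
  shows "\<exists>v. \<forall>x. (\<Prod>j\<in>J. int x - b j) = (\<Sum>c\<le>card J. v c * int (x choose c))"
  using assms
proof (induction J)
  case empty
  show ?case by (rule exI[of _ "\<lambda>_. 1"]) simp
next
  case (insert s J)
  then obtain v where v: "\<And>x. (\<Prod>j\<in>J. int x - b j) = (\<Sum>c\<le>card J. v c * int (x choose c))" by blast
  \<comment> \<open>The first summand collects what stays at index \<open>c\<close>, the second what
    moves up from \<open>d\<close> to \<open>Suc d\<close>. The cutoff is there because nothing is
    known about \<open>v\<close> beyond \<open>card J\<close>.\<close>
  define v' where "v' c = (if c \<le> card J then v c * (int c - b s) else 0) +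
    (case c of 0 \<Rightarrow> 0 | Suc d \<Rightarrow> v d * int c)" for c
  have step: "(int x - b s) * int (x choose c)
      = int (Suc c) * int (x choose Suc c) + (int c - b s) * int (x choose c)" for x c
  proof -
    have "int (Suc c) * int (x choose Suc c) = (int x - int c) * int (x choose c)"
    proof (cases "c \<le> x")
      case True
      have "Suc c * (x choose Suc c) = (x - c) * (x choose c)"
        unfolding binomial_absorption binomial_absorb_comp ..
      then show ?thesis using True by (metis of_nat_diff of_nat_mult)
    qed (simp add: binomial_eq_0)
    then show ?thesis by (simp only:) (simp add: algebra_simps)
  qed
  have "(\<Prod>j\<in>insert s J. int x - b j) = (\<Sum>c\<le>card (insert s J). v' c * int (x choose c))" for x
  proof -
    have "(\<Prod>j\<in>insert s J. int x - b j) = (\<Sum>c\<le>card J. v c * ((int x - b s) * int (x choose c)))"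
      using insert v by (simp add: sum_distrib_left mult.left_commute)
    also have "\<dots> = (\<Sum>c\<le>card J. v c * int (Suc c) * int (x choose Suc c))
        + (\<Sum>c\<le>card J. v c * (int c - b s) * int (x choose c))"
      unfolding step distrib_left sum.distrib by (simp only: mult.assoc)
    also have "(\<Sum>c\<le>card J. v c * int (Suc c) * int (x choose Suc c))
        = (\<Sum>c\<le>Suc (card J). (case c of 0 \<Rightarrow> 0 | Suc d \<Rightarrow> v d * int c) * int (x choose c))"
      unfolding sum.atMost_Suc_shift by simp
    also have "(\<Sum>c\<le>card J. v c * (int c - b s) * int (x choose c))
        = (\<Sum>c\<le>Suc (card J). (if c \<le> card J then v c * (int c - b s) else 0) * int (x choose c))"
      by simp
    finally show ?thesis
      using insert by (simp only: v'_def sum.distrib distrib_right card_insert_disjoint) simp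
  qed
  then show ?case by blast
qed

text \<open>The polynomials \<open>\<Prod>j\<noteq>i. X - a j\<close> are integer combinations of binomial coefficients, so the
  binomial matrix times an integer matrix is diagonal with entries prime to \<open>p\<close>.\<close>

lemma prime_not_dvd_det_binomial:
  fixes a :: "nat \<Rightarrow> nat"
  assumes p: "prime p" and inj: "inj_on a {..<k}" and lt: "a ` {..<k} \<subseteq> {..<p}"
  shows "\<not> int p dvd det (mat k k (\<lambda>(c, i). int (a i choose c)))"
    (is "\<not> _ dvd det ?B")
proof
  assume dvd: "int p dvd det ?B"
  have "\<forall>i\<in>{..<k}. \<exists>v. \<forall>x. (\<Prod>j\<in>{..<k} - {i}. int x - int (a j)) = (\<Sum>c<k. v c * int (x choose c))"
  proof
    fix i assume i: "i \<in> {..<k}"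
    then have "{..card ({..<k} - {i})} = {..<k}" by auto
    with prod_diff_binomial_expansion[of "{..<k} - {i}" "\<lambda>j. int (a j)"]
    show "\<exists>v. \<forall>x. (\<Prod>j\<in>{..<k} - {i}. int x - int (a j)) = (\<Sum>c<k. v c * int (x choose c))" by simp
  qed
  from bchoice[OF this] obtain v where v: "\<And>i x. i < k \<Longrightarrow>
      (\<Prod>j\<in>{..<k} - {i}. int x - int (a j)) = (\<Sum>c<k. v i c * int (x choose c))" by blast
  let ?V = "mat k k (\<lambda>(i, c). v i c)"
  have VB: "(?V * ?B) $$ (i, l) = (\<Prod>j\<in>{..<k} - {i}. int (a l) - int (a j))" if "i < k" "l < k" for i l
    unfolding v[OF that(1)] using that by (simp add: scalar_prod_def lessThan_atLeast0)
  have "upper_triangular (?V * ?B)"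
  proof (rule upper_triangularI)
    fix i j assume "j < i" "i < dim_row (?V * ?B)"
    then have "j \<in> {..<k} - {i}" "i < k" "j < k" by auto
    then show "(?V * ?B) $$ (i, j) = 0"
      unfolding VB[OF \<open>i < k\<close> \<open>j < k\<close>] by (intro prod_zero) auto
  qed
  then have "det (?V * ?B) = prod_list (diag_mat (?V * ?B))"
    by (rule det_upper_triangular[where n = k]) (intro mult_carrier_mat[of _ k k] mat_carrier)
  also have "\<dots> = (\<Prod>i<k. \<Prod>j\<in>{..<k} - {i}. int (a i) - int (a j))"
    by (auto simp: prod_list_diag_prod VB lessThan_atLeast0 simp del: index_mult_mat(1) intro!: prod.cong)
  finally have "det ?V * det ?B = (\<Prod>i<k. \<Prod>j\<in>{..<k} - {i}. int (a i) - int (a j))"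
    by (subst (asm) det_mult[of _ k]) simp_all
  then have "int p dvd (\<Prod>i<k. \<Prod>j\<in>{..<k} - {i}. int (a i) - int (a j))"
    using dvd by (metis dvd_mult)
  then obtain i j where ij: "i < k" "j < k" "j \<noteq> i" and "int p dvd int (a i) - int (a j)"
    using p by (auto simp: prime_dvd_prod_iff)
  then have "[a i = a j] (mod p)" by (simp add: cong_iff_dvd_diff flip: cong_int_iff)
  then have "a i = a j" using ij lt by (auto intro!: cong_less_modulus_unique_nat)
  then show False using ij inj by (auto dest: inj_onD)
qed

section \<open>Chebotarev's theorem and Tao's inequality\<close>

lemma power_eq_one_prime_iff:
  fixes w :: complex
  assumes "w ^ p = 1" "w \<noteq> 1" "prime p"
  shows "w ^ n = 1 \<longleftrightarrow> p dvd n"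
proof
  assume wn: "w ^ n = 1"
  show "p dvd n"
  proof (rule ccontr)
    assume "\<not> p dvd n"
    then have "coprime p n" using assms(3) prime_imp_coprime coprime_commute by blast
    moreover have "n \<noteq> 0" using \<open>\<not> p dvd n\<close> by (metis dvd_0_right)
    ultimately obtain s t where "n * s = p * t + 1"
      using bezout_nat[of n p] by (metis coprime_commute coprime_iff_gcd_eq_1)
    then have "w ^ (n * s) = w ^ (p * t + 1)" by simp
    then show False using wn assms by (simp add: power_mult power_add)
  qed
next
  assume "p dvd n"
  then show "w ^ n = 1" using assms by (auto simp: power_mult)
qed

lemma inj_on_power_root_of_unity:
  fixes w :: complex
  assumes w: "w ^ p = 1" "w \<noteq> 1" and p: "prime p"
  shows "inj_on (\<lambda>n. w ^ n) {..<p}"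
proof (rule linorder_inj_onI')
  fix m n assume mn: "m \<in> {..<p}" "n \<in> {..<p}" "m < n"
  show "w ^ m \<noteq> w ^ n"
  proof
    assume "w ^ m = w ^ n"
    also have "\<dots> = w ^ m * w ^ (n - m)" using mn by (simp flip: power_add)
    finally have "w ^ (n - m) = 1" using w p by (auto simp: power_0_left)
    then have "p dvd n - m" using power_eq_one_prime_iff[OF w p] by blast
    then show False using mn by (auto dest: dvd_imp_le)
  qed
qed

text \<open>The Fourier minor itself says nothing at \<open>w = 1\<close>, where all its entries are
  1. Divided differences of its rows annihilate the same vector \<open>f\<close> but become binomial
  coefficients there.\<close>

theorem chebotarev_minor:
  fixes w :: complex and a b :: "nat \<Rightarrow> nat"
  assumes w: "w ^ p = 1" "w \<noteq> 1" and p: "prime p"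
    and a: "inj_on a {..<k}" "a ` {..<k} \<subseteq> {..<p}"
    and b: "inj_on b {..<k}" "b ` {..<k} \<subseteq> {..<p}"
    and zero: "\<And>c. c < k \<Longrightarrow> (\<Sum>i<k. f i * w ^ (b c * a i)) = 0"
    and i: "i < k"
  shows "f i = 0"
proof (rule ccontr)
  assume fi: "f i \<noteq> 0"
  \<comment> \<open>The polynomial variable stands for \<open>w\<close>: evaluation at
    \<open>w\<close> gives the singular matrix, evaluation at 1 the binomial one.\<close>
  define D :: "int poly mat"
    where "D = mat k k (\<lambda>(c, i). newton (\<lambda>c. [:0, 1:] ^ b c) c (a i) ([:0, 1:] ^ b c))"
  have D: "D \<in> carrier_mat k k" by (simp add: D_def)
  interpret ev: comm_ring_hom "\<lambda>Q. poly (of_int_poly Q) w"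
    by unfold_locales (simp_all add: of_int_poly_hom.hom_add of_int_poly_hom.hom_mult)
  have ev1: "comm_ring_hom (\<lambda>Q::int poly. poly Q 1)"
    by unfold_locales simp_all
  have inj: "inj_on (\<lambda>c. w ^ b c) {..<k}"
    using comp_inj_on[OF b(1) inj_on_subset[OF inj_on_power_root_of_unity[OF w p] b(2)]]
    by (simp add: comp_def)
  let ?A = "map_mat (\<lambda>Q. poly (of_int_poly Q) w) D" and ?f = "vec k f"
  have "?A *\<^sub>v ?f = 0\<^sub>v k"
  proof (rule eq_vecI)
    fix c assume c: "c < dim_vec (0\<^sub>v k :: complex vec)"
    have "(?A *\<^sub>v ?f) $ c = (\<Sum>i<k. f i * newton (\<lambda>c. w ^ b c) c (a i) (w ^ b c))"
      using c by (simp add: D_def scalar_prod_def lessThan_atLeast0 ev.hom_newton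
          of_int_poly_hom.hom_power mult.commute)
    also have "\<dots> = 0"
      by (rule sum_newton_eq_0[OF inj]) (use c zero in \<open>simp_all add: power_mult\<close>)
    finally show "(?A *\<^sub>v ?f) $ c = 0\<^sub>v k $ c" using c by simp
  qed (simp add: D_def)
  moreover have "?f \<noteq> 0\<^sub>v k"
  proof
    assume "?f = 0\<^sub>v k"
    then have "?f $ i = 0\<^sub>v k $ i" by simp
    then show False using i fi by simp
  qed
  ultimately have "det ?A = 0"
    using D by (intro iffD2[OF det_0_iff_vec_prod_zero[of ?A k]] exI[of _ ?f]) auto
  then have "poly (of_int_poly (det D)) w = 0" by simp
  then have "int p dvd poly (det D) 1" by (rule prime_dvd_poly_1[OF w(1) p])
  also have "poly (det D) 1 = det (map_mat (\<lambda>Q. poly Q 1) D)"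
    by (rule comm_ring_hom.hom_det[OF ev1, symmetric])
  also have "map_mat (\<lambda>Q. poly Q 1) D = mat k k (\<lambda>(c, i). int (a i choose c))"
    by (rule eq_matI) (simp_all add: D_def comm_ring_hom.hom_newton[OF ev1] newton_one)
  finally show False using prime_not_dvd_det_binomial[OF p a] by simp
qed

text \<open>If the inequality failed, the transform would have at least as many zeros as
  \<open>g\<close> has support points. A square minor would then force \<open>g\<close> to vanish on
  its own support.\<close>

theorem prime_uncertainty:
  fixes w :: complex and g :: "nat \<Rightarrow> complex"
  assumes w: "w ^ p = 1" "w \<noteq> 1" and p: "prime p" and i: "i < p" "g i \<noteq> 0"
  shows "p + 1 \<le> card {i \<in> {..<p}. g i \<noteq> 0} + card {j \<in> {..<p}. (\<Sum>i<p. g i * w ^ (j * i)) \<noteq> 0}"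
proof (rule ccontr)
  define S where "S = {i \<in> {..<p}. g i \<noteq> 0}"
  define Z where "Z = {j \<in> {..<p}. (\<Sum>i<p. g i * w ^ (j * i)) = 0}"
  define N where "N = {j \<in> {..<p}. (\<Sum>i<p. g i * w ^ (j * i)) \<noteq> 0}"
  assume "\<not> p + 1 \<le> card {i \<in> {..<p}. g i \<noteq> 0} + card {j \<in> {..<p}. (\<Sum>i<p. g i * w ^ (j * i)) \<noteq> 0}"
  then have "card S + card N \<le> p" by (simp add: S_def N_def)
  moreover have "card Z + card N = p"
  proof -
    have "Z \<union> N = {..<p}" "Z \<inter> N = {}" by (auto simp: Z_def N_def)
    then show ?thesis using card_Un_disjoint[of Z N] by (simp add: Z_def N_def)
  qed
  ultimately have "card S \<le> card Z" by simp
  then obtain Z' where Z': "Z' \<subseteq> Z" "card Z' = card S" "finite Z'"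
    by (rule obtain_subset_with_card_n)
  have "finite S" by (simp add: S_def)
  then obtain a where a: "bij_betw a {..<card S} S"
    using ex_bij_betw_nat_finite by (auto simp: lessThan_atLeast0)
  obtain b where b: "bij_betw b {..<card S} Z'"
    using ex_bij_betw_nat_finite[OF Z'(3)] Z'(2) by (auto simp: lessThan_atLeast0)
  have "i \<in> a ` {..<card S}" using i a by (simp add: S_def bij_betw_def)
  then obtain l where l: "l < card S" "a l = i" by auto
  have "inj_on a {..<card S}" "a ` {..<card S} \<subseteq> {..<p}"
    using a unfolding bij_betw_def by (simp_all, auto simp: S_def)
  moreover have "inj_on b {..<card S}" "b ` {..<card S} \<subseteq> {..<p}"
    using b Z'(1) unfolding bij_betw_def by (simp_all, auto simp: Z_def)
  ultimately have "g (a l) = 0"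
  proof (rule chebotarev_minor[OF w p, where f = "\<lambda>i. g (a i)"])
    show "l < card S" by (rule l)
    fix c assume "c < card S"
    then have "b c \<in> Z" using bij_betw_apply[OF b, of c] Z'(1) by auto
    then have "0 = (\<Sum>i<p. g i * w ^ (b c * i))" by (simp add: Z_def)
    also have "\<dots> = (\<Sum>i\<in>S. g i * w ^ (b c * i))"
      by (rule sum.mono_neutral_right) (auto simp: S_def)
    also have "\<dots> = (\<Sum>i<card S. g (a i) * w ^ (b c * a i))"
      by (rule sum.reindex_bij_betw[OF a, symmetric])
    finally show "(\<Sum>i<card S. g (a i) * w ^ (b c * a i)) = 0" by simp
  qed
  then show False using l i by simp
qed

section \<open>The interpolated bound\<close>

definition lower_divisor :: "nat \<Rightarrow> nat \<Rightarrow> nat"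
  where "lower_divisor n k = Max {d. d dvd n \<and> d \<le> k}"

definition upper_divisor :: "nat \<Rightarrow> nat \<Rightarrow> nat"
  where "upper_divisor n k = Min {d. d dvd n \<and> k \<le> d}"

text \<open>For \<open>a \<noteq> b\<close> this is the line through the points of the hyperbola
  \<open>n / x\<close> at \<open>a\<close> and \<open>b\<close>; for \<open>a = b\<close> it is the
  tangent at \<open>a\<close>, so the case of \<open>k\<close> dividing \<open>n\<close> needs no
  separate treatment.\<close>

definition chord :: "real \<Rightarrow> real \<Rightarrow> real \<Rightarrow> real \<Rightarrow> real"
  where "chord n a b x = n / (a * b) * (a + b - x)"

definition meshulam_bound :: "nat \<Rightarrow> nat \<Rightarrow> real"
  where "meshulam_bound n k = chord n (lower_divisor n k) (upper_divisor n k) k"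

lemma
  assumes "1 \<le> k"
  shows lower_divisor_dvd: "lower_divisor n k dvd n"
    and lower_divisor_le: "lower_divisor n k \<le> k"
    and lower_divisor_pos: "1 \<le> lower_divisor n k"
    and le_lower_divisor: "\<And>d. d dvd n \<Longrightarrow> d \<le> k \<Longrightarrow> d \<le> lower_divisor n k"
proof -
  let ?D = "{d. d dvd n \<and> d \<le> k}"
  have fin: "finite ?D" by (rule finite_subset[of _ "{..k}"]) auto
  moreover have "1 \<in> ?D" using assms by simp
  ultimately have "Max ?D \<in> ?D" "1 \<le> Max ?D" using Max_in[of ?D] Max_ge[of ?D 1] by blast+
  then show "lower_divisor n k dvd n" "lower_divisor n k \<le> k" "1 \<le> lower_divisor n k"
    by (simp_all add: lower_divisor_def)
  show "d \<le> lower_divisor n k" if "d dvd n" "d \<le> k" for d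
    unfolding lower_divisor_def using fin that by (intro Max_ge) auto
qed

lemma
  assumes "k \<le> n" and "0 < n"
  shows upper_divisor_dvd: "upper_divisor n k dvd n"
    and upper_divisor_ge: "k \<le> upper_divisor n k"
    and upper_divisor_le: "\<And>d. d dvd n \<Longrightarrow> k \<le> d \<Longrightarrow> upper_divisor n k \<le> d"
proof -
  let ?D = "{d. d dvd n \<and> k \<le> d}"
  have fin: "finite ?D" by (rule finite_subset[of _ "{..n}"]) (use assms dvd_imp_le in auto)
  moreover have "n \<in> ?D" using assms by simp
  ultimately have "Min ?D \<in> ?D" using Min_in[of ?D] by blast
  then show "upper_divisor n k dvd n" "k \<le> upper_divisor n k"
    by (simp_all add: upper_divisor_def)
  show "upper_divisor n k \<le> d" if "d dvd n" "k \<le> d" for d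
    unfolding upper_divisor_def using fin that by (intro Min_le) auto
qed

lemma chord_left: "a \<noteq> 0 \<Longrightarrow> b \<noteq> 0 \<Longrightarrow> chord n a b a = n / a"
  by (simp add: chord_def)

lemma chord_right: "a \<noteq> 0 \<Longrightarrow> b \<noteq> 0 \<Longrightarrow> chord n a b b = n / b"
  by (simp add: chord_def)

lemma chord_antimono:
  "0 < a \<Longrightarrow> 0 < b \<Longrightarrow> 0 \<le> n \<Longrightarrow> x \<le> y \<Longrightarrow> chord n a b y \<le> chord n a b x"
  unfolding chord_def by (intro mult_left_mono) auto

text \<open>The hyperbola is convex, so its chord over a smaller interval lies lower.\<close>

lemma chord_widen:
  assumes "0 < a" "a \<le> c" "c \<le> x" "x \<le> d" "d \<le> b" "0 \<le> n"
  shows "chord n c d x \<le> chord n a b x"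
proof -
  \<comment> \<open>The difference of the two chords with denominators cleared. It is affine in
    \<open>y\<close>, so its sign at \<open>c\<close> and \<open>d\<close> suffices.\<close>
  define F where "F y = c * d * (a + b - y) - a * b * (c + d - y)" for y
  have Fc: "F c = d * ((c - a) * (b - c))" and Fd: "F d = c * ((d - a) * (b - d))"
    by (simp_all add: F_def algebra_simps)
  have nonneg: "0 \<le> F c" "0 \<le> F d" unfolding Fc Fd using assms by simp_all
  have "0 \<le> F x"
  proof (cases "c = d")
    case False
    have "(d - c) * F x = (d - x) * F c + (x - c) * F d" by (simp add: F_def algebra_simps)
    also have "\<dots> \<ge> 0" using nonneg assms by simp
    finally show ?thesis using False assms by (simp add: zero_le_mult_iff)
  qed (use nonneg assms in simp)
  then have "(c + d - x) / (c * d) \<le> (a + b - x) / (a * b)"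
    using assms by (simp add: F_def divide_simps mult.commute)
  then have "n * ((c + d - x) / (c * d)) \<le> n * ((a + b - x) / (a * b))"
    using assms by (intro mult_left_mono)
  then show ?thesis by (simp add: chord_def)
qed

text \<open>The bound uses the closest divisors around \<open>k\<close>, hence the lowest chord.
  Estimates from above may thus choose any convenient divisors.\<close>

lemma meshulam_bound_le_chord:
  assumes "a dvd n" "b dvd n" "a \<le> k" "k \<le> b" "0 < n" "1 \<le> k"
  shows "meshulam_bound n k \<le> chord n a b k"
proof -
  have "k \<le> n" using assms dvd_imp_le le_trans by blast
  with assms show ?thesis unfolding meshulam_bound_def
    using lower_divisor_le[of k n] upper_divisor_ge[of k n] le_lower_divisor[of k a n]
      upper_divisor_le[of k n b]
    by (intro chord_widen) (auto intro!: Nat.gr0I)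
qed

text \<open>If a divisor \<open>d\<close> of \<open>n\<close> lies between \<open>j\<close> and
  \<open>k\<close>, both sides are compared with \<open>n / d\<close>; otherwise the chord used for
  \<open>j\<close> also reaches over \<open>k\<close>.\<close>

lemma meshulam_bound_antimono:
  assumes "1 \<le> j" "j \<le> k" "k \<le> n"
  shows "meshulam_bound n k \<le> meshulam_bound n j"
proof (cases "upper_divisor n j \<le> k")
  case True
  define d where "d = upper_divisor n j"
  have n: "0 < n" using assms by simp
  have d: "d dvd n" "j \<le> d" "d \<le> k" using assms True
    by (simp_all add: d_def upper_divisor_dvd upper_divisor_ge)
  have c: "1 \<le> lower_divisor n j" by (rule lower_divisor_pos[OF assms(1)])
  have "meshulam_bound n k \<le> chord n d n k"
    using d assms n by (intro meshulam_bound_le_chord) auto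
  also have "\<dots> \<le> chord n d n d" using d assms by (intro chord_antimono) auto
  also have "\<dots> = chord n (lower_divisor n j) d d"
    using d assms c by (simp add: chord_left chord_right)
  also have "\<dots> \<le> meshulam_bound n j"
    unfolding meshulam_bound_def using d assms c by (fold d_def, intro chord_antimono) auto
  finally show ?thesis .
next
  case False
  have n: "0 < n" "1 \<le> k" "j \<le> n" using assms by simp_all
  have pos: "1 \<le> lower_divisor n j" by (rule lower_divisor_pos[OF assms(1)])
  have "meshulam_bound n k \<le> chord n (lower_divisor n j) (upper_divisor n j) k"
    using n False assms lower_divisor_le[OF assms(1), of n]
    by (intro meshulam_bound_le_chord lower_divisor_dvd upper_divisor_dvd) auto
  also have "\<dots> \<le> meshulam_bound n j"
    unfolding meshulam_bound_def using pos assms upper_divisor_ge[of j n] n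
    by (intro chord_antimono) auto
  finally show ?thesis .
qed

text \<open>On the hyperbola \<open>s * t = K\<close> the product \<open>(A - s) * (B - t)\<close> times \<open>s\<close> is a concave
  quadratic in \<open>s\<close>, so it is controlled by the two ends of the arc.\<close>

lemma hyperbola_arc_bound:
  fixes A B C K s l u :: real
  assumes "0 < l" "l \<le> s" "s \<le> u" "0 \<le> B"
    and l: "C \<le> (A - l) * (B - K / l)" and u: "C \<le> (A - u) * (B - K / u)"
  shows "C \<le> (A - s) * (B - K / s)"
proof -
  define q where "q x = (A - x) * (B * x - K) - C * x" for x
  have q: "q x = x * ((A - x) * (B - K / x) - C)" if "0 < x" for x
    using that by (simp add: q_def field_simps)
  have ql: "0 \<le> q l" and qu: "0 \<le> q u" using assms by (simp_all add: q)
  have "0 \<le> q s"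
  proof (cases "l = u")
    case False
    \<comment> \<open>The last summand is the excess of a quadratic with leading coefficient
      \<open>- B\<close> over its linear interpolation.\<close>
    have "(u - l) * q s = (u - s) * q l + (s - l) * q u + B * ((u - l) * (s - l) * (u - s))"
      by (simp add: q_def algebra_simps)
    also have "\<dots> \<ge> 0" using assms ql qu by (intro add_nonneg_nonneg mult_nonneg_nonneg) auto
    finally show ?thesis using False assms by (simp add: zero_le_mult_iff)
  qed (use assms ql in simp)
  then show ?thesis using assms by (simp add: q zero_le_mult_iff)
qed

text \<open>For fixed \<open>K = s * t\<close> only the ends of the admissible arc of the hyperbola
  matter. There the right-hand side is, up to scaling, the chord of \<open>p * m\<close> at
  \<open>K\<close> between two of the divisors \<open>a\<close>, \<open>b\<close>,
  \<open>p * a\<close>, \<open>p * b\<close>.\<close>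

lemma meshulam_bound_mult_prime:
  assumes p: "prime p" and s: "1 \<le> s" "s \<le> m" and t: "1 \<le> t" "t \<le> p"
  shows "meshulam_bound (p * m) (s * t) \<le> meshulam_bound m s * (p + 1 - real t)"
proof -
  define a b K where "a = lower_divisor m s" and "b = upper_divisor m s" and "K = s * t"
  have m: "0 < m" using s by simp
  have p0: "0 < p" using p prime_gt_0_nat by blast
  have a: "a dvd m" "a \<le> s" "1 \<le> a"
    using s unfolding a_def by (simp_all only: lower_divisor_dvd lower_divisor_le lower_divisor_pos)
  have b: "b dvd m" "s \<le> b" using s by (simp_all add: b_def upper_divisor_dvd upper_divisor_ge)
  have K: "a \<le> K" "K \<le> p * b" "1 \<le> K"
    using a b s t mult_le_mono[of 1 t a s] mult_le_mono[of s b t p] by (simp_all add: K_def mult.commute)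
  let ?u = "meshulam_bound (p * m) K"
  have u: "?u \<le> chord (real (p * m)) c d K" if "c dvd p * m" "d dvd p * m" "c \<le> K" "K \<le> d" for c d :: nat
    using that K m p0 by (intro meshulam_bound_le_chord) auto
  define C where "C = ?u * (real a * real b) / real m"
  have pos: "0 < real a" "0 < real b" "0 < real m" "0 < real p" "0 < real K"
    using a b m p0 s K by simp_all
  have C: "C \<le> y * (real a * real b) / real m" if "?u \<le> y" for y
    unfolding C_def using that by (intro divide_right_mono mult_right_mono) simp_all
  \<comment> \<open>The range comes from \<open>a \<le> s \<le> b\<close> together with
    \<open>1 \<le> t \<le> p\<close>, that is, \<open>K / p \<le> s \<le> K\<close>.\<close>
  let ?A = "real a + real b" and ?B = "real p + 1"
  let ?l = "max (real a) (K / p)" and ?r = "min (real b) K"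
  have "C \<le> (?A - s) * (?B - K / s)"
  proof (rule hyperbola_arc_bound[of ?l s ?r])
    show "0 < ?l" using a by simp
    show "0 \<le> ?B" by simp
    show "?l \<le> s" using a s t p0 by (simp add: K_def field_simps)
    show "s \<le> ?r" using b s t by (simp add: K_def)
    show "C \<le> (?A - ?l) * (?B - K / ?l)"
    proof (cases "K \<le> p * a")
      case True
      then have "?l = a" using p0 by (simp add: max_def field_simps flip: of_nat_mult)
      have "?u \<le> chord (real (p * m)) a (p * a) K" using u[of a "p * a"] a K True by simp
      from C[OF this] have "C \<le> chord (real (p * m)) a (p * a) K * (real a * real b) / real m" .
      also have "\<dots> = (?A - real a) * (?B - K / real a)"
        unfolding chord_def using pos by (simp add: field_simps)
      finally show ?thesis unfolding \<open>?l = a\<close> .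
    next
      case False
      then have "?l = K / p" using p0 by (simp add: max_def field_simps flip: of_nat_mult)
      have "?u \<le> chord (real (p * m)) (p * a) (p * b) K" using u[of "p * a" "p * b"] a b K False by simp
      from C[OF this] have "C \<le> chord (real (p * m)) (p * a) (p * b) K * (real a * real b) / real m" .
      also have "\<dots> = (?A - (K / p)) * (?B - K / (K / p))"
        unfolding chord_def using pos by (simp add: field_simps)
      finally show ?thesis unfolding \<open>?l = K / p\<close> .
    qed
    show "C \<le> (?A - ?r) * (?B - K / ?r)"
    proof (cases "K \<le> b")
      case True
      then have "?r = K" by simp
      have "?u \<le> chord (real (p * m)) a b K" using u[of a b] a b K True by simp
      from C[OF this] have "C \<le> chord (real (p * m)) a b K * (real a * real b) / real m" .
      also have "\<dots> = (?A - real K) * (?B - K / real K)"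
        unfolding chord_def using pos by (simp add: field_simps)
      finally show ?thesis unfolding \<open>?r = K\<close> .
    next
      case False
      then have "?r = b" by simp
      have "?u \<le> chord (real (p * m)) b (p * b) K" using u[of b "p * b"] a b K False by simp
      from C[OF this] have "C \<le> chord (real (p * m)) b (p * b) K * (real a * real b) / real m" .
      also have "\<dots> = (?A - real b) * (?B - K / real b)"
        unfolding chord_def using pos by (simp add: field_simps)
      finally show ?thesis unfolding \<open>?r = b\<close> .
    qed
  qed
  then show ?thesis
    unfolding meshulam_bound_def[of m] chord_def a_def[symmetric] b_def[symmetric] C_def K_def[symmetric]
    using a b m s by (simp add: K_def field_simps)
qed

section \<open>Characters and subgroups of prime index\<close>

context group
begin

lemma
  assumes "\<chi> \<in> hom G complex_mult_group"
  shows character_nonzero: "x \<in> carrier G \<Longrightarrow> \<chi> x \<noteq> 0"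
    and character_mult: "x \<in> carrier G \<Longrightarrow> y \<in> carrier G \<Longrightarrow> \<chi> (x \<otimes> y) = \<chi> x * \<chi> y"
  using assms by (auto simp: hom_def complex_mult_group_def)

lemma character_one:
  assumes "\<chi> \<in> hom G complex_mult_group"
  shows "\<chi> \<one> = 1"
  using character_mult[OF assms, of \<one> \<one>] character_nonzero[OF assms, of \<one>] by simp

lemma character_inv:
  assumes "\<chi> \<in> hom G complex_mult_group" and "x \<in> carrier G"
  shows "\<chi> (inv x) = inverse (\<chi> x)"
  using character_mult[OF assms(1), of "inv x" x] character_one[OF assms(1)] assms(2)
  by (simp add: inverse_unique[symmetric] mult.commute)

lemma character_nat_pow:
  assumes "\<chi> \<in> hom G complex_mult_group" and "x \<in> carrier G"
  shows "\<chi> (x [^] (i::nat)) = \<chi> x ^ i"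
  using assms by (induction i) (simp_all add: character_one character_mult)

text \<open>Character values are roots of unity of order dividing \<open>order G\<close>, and
  extensionality leaves no freedom off the carrier.\<close>

lemma finite_character_group:
  assumes fin: "finite (carrier G)"
  shows "finite (carrier (character_group G))"
proof (rule finite_subset)
  show "finite (PiE (carrier G) (\<lambda>_. {z::complex. z ^ order G = 1}))"
    using fin by (intro finite_PiE finite_nth_roots) (auto simp: order_gt_0_iff_finite)
  show "carrier (character_group G) \<subseteq> PiE (carrier G) (\<lambda>_. {z. z ^ order G = 1})"
  proof
    fix \<chi> assume "\<chi> \<in> carrier (character_group G)"
    then have \<chi>: "\<chi> \<in> hom G complex_mult_group" "\<chi> \<in> extensional (carrier G)"
      by (simp_all add: character_group_def)
    have "\<chi> x ^ order G = 1" if "x \<in> carrier G" for x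
      using character_nat_pow[OF \<chi>(1) that, of "order G"] pow_order_eq_1[OF that]
        character_one[OF \<chi>(1)] by simp
    with \<chi> show "\<chi> \<in> PiE (carrier G) (\<lambda>_. {z. z ^ order G = 1})" by (simp add: PiE_def)
  qed
qed

end

text \<open>The quotient by \<open>H\<close> is cyclic of order \<open>q\<close>, generated by the
  coset of \<open>b\<close>. The representative \<open>b\<close> is fixed because a character of
  \<open>H\<close> is extended by choosing its value at \<open>b\<close>.\<close>

locale prime_index_subgroup = comm_group G + subgroup H G for H and G (structure) +
  fixes b :: 'a and q :: nat
  assumes b: "b \<in> carrier G" and q: "prime q" and bq: "b [^] q \<in> H"
    and bi: "\<And>i. 0 < i \<Longrightarrow> i < q \<Longrightarrow> b [^] i \<notin> H"
    and cover: "\<And>x. x \<in> carrier G \<Longrightarrow> \<exists>i::nat. \<exists>h\<in>H. x = b [^] i \<otimes> h"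

text \<open>\<open>H\<close> is a maximal proper subgroup. A suitable power \<open>b\<close> of an
  element outside \<open>H\<close> has prime order modulo \<open>H\<close>, and maximality makes
  \<open>H\<close> and \<open>b\<close> generate \<open>G\<close>.\<close>

lemma (in comm_group) obtains_prime_index_subgroup:
  assumes fin: "finite (carrier G)" and nontriv: "order G \<noteq> 1"
  obtains H b q where "prime_index_subgroup H G b q"
proof -
  let ?S = "{H. subgroup H G \<and> H \<noteq> carrier G}"
  have "finite ?S"
    by (rule finite_subset[of _ "Pow (carrier G)"]) (use fin subgroup.subset in auto)
  moreover have "{\<one>} \<in> ?S"
  proof -
    have "card {\<one>} \<noteq> card (carrier G)" using nontriv unfolding order_def by simp
    then have "{\<one>} \<noteq> carrier G" by metis
    then show ?thesis using triv_subgroup by simp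
  qed
  ultimately obtain H where "H \<in> ?S" and max: "\<And>K. K \<in> ?S \<Longrightarrow> H \<subseteq> K \<Longrightarrow> H = K"
    using finite_has_maximal[of ?S] by (metis (no_types, lifting) empty_iff)
  then have H: "subgroup H G" "H \<noteq> carrier G" by simp_all
  then obtain a where a: "a \<in> carrier G" "a \<notin> H" using subgroup.subset by blast
  \<comment> \<open>The order of \<open>a\<close> modulo \<open>H\<close>.\<close>
  define m where "m = (LEAST i::nat. 0 < i \<and> a [^] i \<in> H)"
  have "0 < order G \<and> a [^] order G \<in> H"
    using fin pow_order_eq_1[OF a(1)] subgroup.one_closed[OF H(1)] by (simp add: order_gt_0_iff_finite)
  then have m: "0 < m \<and> a [^] m \<in> H" unfolding m_def by (rule LeastI[of "\<lambda>i::nat. 0 < i \<and> a [^] i \<in> H"])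
  have less_m: "a [^] i \<notin> H" if "0 < i" "i < m" for i
    using that not_less_Least[of i "\<lambda>i::nat. 0 < i \<and> a [^] i \<in> H"] by (simp add: m_def)
  have "m \<noteq> 1" using m a by (metis nat_pow_eone)
  then obtain q where q: "prime q" "q dvd m" using prime_factor_nat by blast
  then obtain r where r: "m = q * r" by blast
  define b where "b = a [^] r"
  have b: "b \<in> carrier G" using a by (simp add: b_def)
  have b_pow: "b [^] i = a [^] (r * i)" for i :: nat using a by (simp add: b_def nat_pow_pow)
  have bi: "b [^] i \<notin> H" if "0 < i" "i < q" for i
    unfolding b_pow using that m by (intro less_m) (auto simp: r)
  have "b \<notin> H" using bi[of 1] b prime_gt_1_nat[OF q(1)] by simp
  let ?K = "H <#> generate G {b}"
  have gen: "subgroup (generate G {b}) G" using b by (intro generate_is_subgroup) simp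
  have K: "subgroup ?K G" by (rule mult_subgroups[OF H(1) gen])
  have "H \<subseteq> ?K"
    using subgroup.one_closed[OF gen] subgroup.mem_carrier[OF H(1)] unfolding set_mult_def by force
  moreover have "b \<in> ?K"
    using subgroup.one_closed[OF H(1)] generate.incl[of b "{b}" G] b unfolding set_mult_def by force
  ultimately have "?K = carrier G" using max[of ?K] K \<open>b \<notin> H\<close> by blast
  have "prime_index_subgroup H G b q"
  proof (intro prime_index_subgroup.intro prime_index_subgroup_axioms.intro)
    show "\<exists>i::nat. \<exists>h\<in>H. x = b [^] i \<otimes> h" if "x \<in> carrier G" for x
    proof -
      have "x \<in> ?K" using that \<open>?K = carrier G\<close> by simp
      then obtain h i where "h \<in> H" "x = h \<otimes> b [^] (i::nat)"
        unfolding set_mult_def generate_pow_on_finite_carrier[OF fin b] by blast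
      then show ?thesis using m_comm b subgroup.mem_carrier[OF H(1)] by (metis nat_pow_closed)
    qed
    show "b [^] q \<in> H" unfolding b_pow using m by (simp add: r mult.commute)
  qed (use b q bi H comm_group_axioms in auto)
  then show thesis by (rule that)
qed

context prime_index_subgroup
begin

abbreviation H_group :: "('a, 'b) monoid_scheme"
  where "H_group \<equiv> G\<lparr>carrier := H\<rparr>"

lemma H_group: "comm_group H_group"
  by (rule group.group_comm_groupI) (auto simp: subgroup_is_group m_comm)

lemma q_pos: "0 < q"
  using q prime_gt_0_nat by blast

lemma pow_mem_iff: "b [^] i \<in> H \<longleftrightarrow> q dvd i" for i :: nat
proof -
  have split: "b [^] i = b [^] (i mod q) \<otimes> (b [^] q) [^] (i div q)"
    using b by (simp add: nat_pow_pow nat_pow_mult mult.commute)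
  have bqi: "(b [^] q) [^] n \<in> H"
    for n :: nat using bq by (induction n) simp_all
  have "b [^] (i mod q) \<in> H" if "b [^] i \<in> H"
  proof -
    have "b [^] (i mod q) = b [^] i \<otimes> inv ((b [^] q) [^] (i div q))"
      unfolding split using b by (simp add: m_assoc)
    then show ?thesis using that bqi by simp
  qed
  then have "b [^] i \<in> H \<longleftrightarrow> b [^] (i mod q) \<in> H"
    unfolding split using bqi[of "i div q"] by auto
  also have "\<dots> \<longleftrightarrow> i mod q = 0"
    using bi[of "i mod q"] q_pos by (cases "i mod q = 0") auto
  finally show ?thesis by (simp add: dvd_eq_mod_eq_0)
qed

lemma bij_betw_transversal: "bij_betw (\<lambda>(i, h). b [^] i \<otimes> h) ({..<q} \<times> H) (carrier G)"
proof (rule bij_betwI')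
  fix x y assume "x \<in> {..<q} \<times> H" "y \<in> {..<q} \<times> H"
  moreover have "i = j \<and> h = h'" if eq: "b [^] i \<otimes> h = b [^] j \<otimes> h'" and ij: "i \<le> j" "j < q"
    and h: "h \<in> H" "h' \<in> H" for i j :: nat and h h'
  proof -
    have "b [^] j = b [^] i \<otimes> b [^] (j - i)" using b ij by (simp add: nat_pow_mult)
    then have "h = b [^] (j - i) \<otimes> h'" using eq b h by (simp add: m_assoc)
    then have "b [^] (j - i) = h \<otimes> inv h'" using b h by (simp add: m_assoc)
    then have "b [^] (j - i) \<in> H" using h by simp
    then have "j - i = 0" using pow_mem_iff ij by (auto dest: dvd_imp_le)
    with ij \<open>h = _\<close> h show ?thesis by simp
  qed
  ultimately show "((case x of (i, h) \<Rightarrow> b [^] i \<otimes> h) = (case y of (i, h) \<Rightarrow> b [^] i \<otimes> h)) = (x = y)"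
    by (cases x; cases y; simp) (metis nat_le_linear)
next
  fix x assume "x \<in> carrier G"
  then obtain i :: nat and h where h: "h \<in> H" "x = b [^] i \<otimes> h" using cover by blast
  have "b [^] i = b [^] (i mod q) \<otimes> b [^] (q * (i div q))"
    using b by (simp add: nat_pow_mult)
  moreover have "b [^] (q * (i div q)) \<in> H" by (simp add: pow_mem_iff)
  ultimately have "x = b [^] (i mod q) \<otimes> (b [^] (q * (i div q)) \<otimes> h)" "b [^] (q * (i div q)) \<otimes> h \<in> H"
    using h b by (simp_all add: m_assoc)
  moreover have "i mod q < q" using q_pos by simp
  ultimately show "\<exists>y\<in>{..<q} \<times> H. x = (case y of (i, h) \<Rightarrow> b [^] i \<otimes> h)"
    by (intro bexI[of _ "(i mod q, b [^] (q * (i div q)) \<otimes> h)"]) auto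
qed (use b in auto)

lemma sum_carrier: "(\<Sum>x\<in>carrier G. F x) = (\<Sum>i<q. \<Sum>h\<in>H. F (b [^] i \<otimes> h))"
  for F :: "'a \<Rightarrow> 'c::comm_monoid_add"
  unfolding sum.cartesian_product sum.reindex_bij_betw[OF bij_betw_transversal, symmetric]
  by (simp add: case_prod_unfold)

lemma order_eq: "order G = q * card H"
  using bij_betw_same_card[OF bij_betw_transversal] by (simp add: order_def card_cartesian_product)

lemma card_H_less: "finite (carrier G) \<Longrightarrow> card H < order G"
proof -
  assume "finite (carrier G)"
  then have "0 < q * card H" by (simp add: order_gt_0_iff_finite flip: order_eq)
  then show ?thesis unfolding order_eq using prime_gt_1_nat[OF q] by simp
qed

section \<open>Extending characters from \<open>H\<close> to \<open>G\<close>\<close>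

definition extension :: "complex \<Rightarrow> ('a \<Rightarrow> complex) \<Rightarrow> 'a \<Rightarrow> complex"
  where "extension z \<psi> =
    (\<lambda>x\<in>carrier G. SOME v. \<exists>i. \<exists>h\<in>H. x = b [^] i \<otimes> h \<and> v = z ^ i * \<psi> h)"

context
  fixes z :: complex and \<psi> :: "'a \<Rightarrow> complex"
  assumes \<psi>: "\<psi> \<in> hom H_group complex_mult_group" and z: "z ^ q = \<psi> (b [^] q)"
begin

lemma H_character_nonzero: "h \<in> H \<Longrightarrow> \<psi> h \<noteq> 0"
  and H_character_mult: "h \<in> H \<Longrightarrow> h' \<in> H \<Longrightarrow> \<psi> (h \<otimes> h') = \<psi> h * \<psi> h'"
  using \<psi> by (auto simp: hom_def complex_mult_group_def)

lemma z_nonzero: "z \<noteq> 0"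
  using z H_character_nonzero[OF bq] q_pos by (auto simp: zero_power)

text \<open>By symmetry \<open>i \<le> j\<close>. Then \<open>j - i\<close> is a multiple of
  \<open>q\<close>, and \<open>z ^ q\<close> was chosen to be the value of \<open>\<psi>\<close> at
  \<open>b [^] q\<close>.\<close>

lemma extension_well_defined:
  assumes "b [^] i \<otimes> h = b [^] j \<otimes> h'" and h: "h \<in> H" "h' \<in> H"
  shows "z ^ i * \<psi> h = z ^ j * \<psi> h'"
  using assms
proof (induction i j arbitrary: h h' rule: linorder_wlog)
  case (le i j)
  have j: "b [^] j = b [^] i \<otimes> b [^] (j - i)" using b le by (simp add: nat_pow_mult)
  then have h: "h = b [^] (j - i) \<otimes> h'" using b le by (simp add: m_assoc)
  then have "b [^] (j - i) = h \<otimes> inv h'" using b le by (simp add: m_assoc)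
  then have "b [^] (j - i) \<in> H" using le by simp
  then obtain r where r: "j - i = q * r" using pow_mem_iff by blast
  have "b [^] (j - i) = (b [^] q) [^]\<^bsub>H_group\<^esub> r"
    using b by (simp add: r nat_pow_pow flip: nat_pow_consistent)
  then have "\<psi> (b [^] (j - i)) = z ^ (j - i)"
    using group.character_nat_pow[OF _ \<psi>, of "b [^] q" r] H_group bq z
    by (simp add: comm_group_def r power_mult)
  then have "\<psi> h = z ^ (j - i) * \<psi> h'"
    using h H_character_mult[of "b [^] (j - i)" h'] le \<open>b [^] (j - i) \<in> H\<close> by simp
  then show ?case using le by (simp flip: power_add)
next
  case (sym i j)
  from sym(1)[OF sym(2)[symmetric] sym(4,3)] show ?case by simp
qed

lemma extension_eq:
  assumes h: "h \<in> H"
  shows "extension z \<psi> (b [^] i \<otimes> h) = z ^ i * \<psi> h"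
proof -
  have "(SOME v. \<exists>j. \<exists>h'\<in>H. b [^] i \<otimes> h = b [^] j \<otimes> h' \<and> v = z ^ j * \<psi> h') = z ^ i * \<psi> h"
  proof (rule some_equality)
    show "\<exists>j. \<exists>h'\<in>H. b [^] i \<otimes> h = b [^] j \<otimes> h' \<and> z ^ i * \<psi> h = z ^ j * \<psi> h'"
      using h by blast
    show "v = z ^ i * \<psi> h" if "\<exists>j. \<exists>h'\<in>H. b [^] i \<otimes> h = b [^] j \<otimes> h' \<and> v = z ^ j * \<psi> h'" for v
      using that extension_well_defined[OF _ h] by metis
  qed
  then show ?thesis using h b by (simp add: extension_def)
qed

lemma extension_hom: "extension z \<psi> \<in> hom G complex_mult_group"
proof (rule homI)
  fix x assume "x \<in> carrier G"
  then obtain i :: nat and h where "h \<in> H" "x = b [^] i \<otimes> h" using cover by blast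
  then show "extension z \<psi> x \<in> carrier complex_mult_group"
    by (simp add: extension_eq complex_mult_group_def z_nonzero H_character_nonzero)
next
  fix x y assume "x \<in> carrier G" "y \<in> carrier G"
  then obtain i j :: nat and h h' where h: "h \<in> H" "h' \<in> H"
    and x: "x = b [^] i \<otimes> h" and y: "y = b [^] j \<otimes> h'" using cover by metis
  have "x \<otimes> y = b [^] (i + j) \<otimes> (h \<otimes> h')"
    using h b by (simp add: x y m_ac nat_pow_mult[symmetric])
  then have "extension z \<psi> (x \<otimes> y) = z ^ (i + j) * (\<psi> h * \<psi> h')"
    using h by (simp add: extension_eq H_character_mult)
  then show "extension z \<psi> (x \<otimes> y) = extension z \<psi> x \<otimes>\<^bsub>complex_mult_group\<^esub> extension z \<psi> y"
    using h by (simp add: x y extension_eq complex_mult_group_def power_add)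
qed

lemma extension_character: "extension z \<psi> \<in> carrier (character_group G)"
  using extension_hom by (simp add: character_group_def extension_def)

lemma fourier_extension:
  "fourier G f (extension z \<psi>) =
    (\<Sum>i<q. inverse z ^ i * fourier H_group (\<lambda>h. f (b [^] i \<otimes> h)) \<psi>)"
proof -
  have "fourier G f (extension z \<psi>)
      = (\<Sum>i<q. \<Sum>h\<in>H. f (b [^] i \<otimes> h) * extension z \<psi> (inv (b [^] i \<otimes> h)))"
    unfolding fourier_def by (rule sum_carrier)
  also have "\<dots> = (\<Sum>i<q. \<Sum>h\<in>H. inverse z ^ i * (f (b [^] i \<otimes> h) * \<psi> (inv\<^bsub>H_group\<^esub> h)))"
  proof (intro sum.cong refl)
    fix i h assume h: "h \<in> H"
    have "extension z \<psi> (inv (b [^] i \<otimes> h)) = inverse (z ^ i * \<psi> h)"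
      using character_inv[OF extension_hom, of "b [^] i \<otimes> h"] b h
      by (simp only: extension_eq) simp
    moreover have "\<psi> (inv\<^bsub>H_group\<^esub> h) = inverse (\<psi> h)"
      using group.character_inv[OF _ \<psi>, of h] H_group h by (simp add: comm_group_def)
    ultimately show "f (b [^] i \<otimes> h) * extension z \<psi> (inv (b [^] i \<otimes> h))
        = inverse z ^ i * (f (b [^] i \<otimes> h) * \<psi> (inv\<^bsub>H_group\<^esub> h))"
      by (simp only: power_inverse inverse_mult_distrib mult_ac)
  qed
  finally show ?thesis by (simp add: fourier_def sum_distrib_left)
qed

end

text \<open>Exponent 0 recovers the character of \<open>H\<close>, exponent 1 the value
  \<open>z\<close>. Hence points of the support found from different pairs are never counted
  twice.\<close>

lemma extension_inj:
  assumes "\<psi> \<in> carrier (character_group H_group)" "z ^ q = \<psi> (b [^] q)"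
    and "\<psi>' \<in> carrier (character_group H_group)" "z' ^ q = \<psi>' (b [^] q)"
    and eq: "extension z \<psi> = extension z' \<psi>'"
  shows "\<psi> = \<psi>'" and "z = z'"
proof -
  have hom: "\<psi> \<in> hom H_group complex_mult_group" "\<psi>' \<in> hom H_group complex_mult_group"
    and ext: "\<psi> \<in> extensional H" "\<psi>' \<in> extensional H"
    using assms by (simp_all add: character_group_def)
  have *: "z ^ i * \<psi> h = z' ^ i * \<psi>' h" if "h \<in> H" for i h
    using extension_eq[OF hom(1) assms(2) that, of i] extension_eq[OF hom(2) assms(4) that, of i]
    unfolding eq by (rule trans[OF sym])
  show "\<psi> = \<psi>'"
    by (rule extensionalityI[OF ext]) (use *[of _ 0] in simp)
  moreover have "\<psi> (b [^] q) \<noteq> 0" by (rule H_character_nonzero[OF hom(1) assms(2) bq])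
  ultimately show "z = z'" using *[OF bq, of 1] by simp
qed

end

section \<open>The uncertainty inequality\<close>

text \<open>Over each \<open>\<psi>\<close> in the support for the coset \<open>i0\<close>, the
  prime case applies to the function \<open>g \<psi>\<close>: it is nonzero at \<open>i0\<close> and
  supported in \<open>T\<close>.\<close>

lemma (in prime_index_subgroup) card_supp_fourier_ge:
  fixes f :: "'a \<Rightarrow> complex"
  defines "f' i \<equiv> \<lambda>h. f (b [^] (i::nat) \<otimes> h)"
  assumes fin: "finite (carrier G)" and i0: "i0 < q"
  shows "card (supp (character_group H_group) (fourier H_group (f' i0)))
      * (q + 1 - card {i \<in> {..<q}. supp H_group (f' i) \<noteq> {}})
    \<le> card (supp (character_group G) (fourier G f))"
proof -
  define \<Psi> where "\<Psi> = supp (character_group H_group) (fourier H_group (f' i0))"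
  define T where "T = {i \<in> {..<q}. supp H_group (f' i) \<noteq> {}}"
  have finH: "finite H" using fin finite_subset[OF subset] by blast
  have finT: "finite T" by (simp add: T_def)
  have \<Psi>: "\<psi> \<in> carrier (character_group H_group)" "\<psi> \<in> hom H_group complex_mult_group"
    and fourier_i0: "fourier H_group (f' i0) \<psi> \<noteq> 0" if "\<psi> \<in> \<Psi>" for \<psi>
    using that by (auto simp: \<Psi>_def supp_def character_group_def)
  have "finite (carrier (character_group H_group))"
    using group.finite_character_group[of H_group] H_group finH by (simp add: comm_group_def)
  then have fin\<Psi>: "finite \<Psi>" by (rule rev_finite_subset) (auto simp: \<Psi>(1))
  obtain w :: complex where w: "w ^ q = 1" "w \<noteq> 1"
  proof -
    have "card {z::complex. z ^ q = 1} = q" using q_pos by (intro card_nth_roots) simp_all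
    then have "\<not> {z::complex. z ^ q = 1} \<subseteq> {1}"
      using card_mono[of "{1::complex}" "{z. z ^ q = 1}"] prime_gt_1_nat[OF q] by auto
    with that show thesis by blast
  qed
  then have "w \<noteq> 0" using q_pos by (auto simp: zero_power)
  have "\<exists>z. z ^ q = c" if "c \<noteq> 0" for c :: complex
    using card_nth_roots[OF that q_pos] q_pos by (metis (mono_tags, lifting) card.empty empty_Collect_eq less_irrefl)
  then have "\<forall>\<psi>\<in>\<Psi>. \<exists>z. z ^ q = \<psi> (b [^] q)"
    using \<Psi>(2) bq by (auto simp: hom_def complex_mult_group_def Pi_iff)
  then obtain z where z: "\<And>\<psi>. \<psi> \<in> \<Psi> \<Longrightarrow> z \<psi> ^ q = \<psi> (b [^] q)" by metis
  define g where "g \<psi> i = inverse (z \<psi>) ^ i * fourier H_group (f' i) \<psi>" for \<psi> i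
  define J where "J \<psi> = {j \<in> {..<q}. (\<Sum>i<q. g \<psi> i * w ^ (j * i)) \<noteq> 0}" for \<psi>
  \<comment> \<open>For \<open>j < q\<close> these are all the \<open>q\<close>-th roots of the
    value of \<open>\<psi>\<close> at \<open>b [^] q\<close>. The inverse of \<open>w\<close>
    appears because the transform inverts \<open>z'\<close> again.\<close>
  define z' where "z' \<psi> j = z \<psi> * inverse w ^ j" for \<psi> j
  have z'_pow: "z' \<psi> j ^ q = \<psi> (b [^] q)" if "\<psi> \<in> \<Psi>" for \<psi> j
  proof -
    have "(inverse w ^ j) ^ q = inverse ((w ^ q) ^ j)"
      by (simp add: power_inverse mult.commute flip: power_mult)
    then show ?thesis using z[OF that] by (simp add: z'_def power_mult_distrib w)
  qed
  have fourier: "fourier G f (extension (z' \<psi> j) \<psi>) = (\<Sum>i<q. g \<psi> i * w ^ (j * i))"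
    if "\<psi> \<in> \<Psi>" for \<psi> j
    unfolding fourier_extension[OF \<Psi>(2)[OF that] z'_pow[OF that]]
    by (simp add: z'_def g_def f'_def power_mult_distrib power_inverse mult_ac flip: power_mult)
  have card_J: "q + 1 - card T \<le> card (J \<psi>)" if "\<psi> \<in> \<Psi>" for \<psi>
  proof -
    have "z \<psi> \<noteq> 0" by (rule z_nonzero[OF \<Psi>(2)[OF that] z[OF that]])
    then have "g \<psi> i0 \<noteq> 0" using fourier_i0[OF that] by (simp add: g_def)
    with w q i0 have "q + 1 \<le> card {i \<in> {..<q}. g \<psi> i \<noteq> 0} + card (J \<psi>)"
      unfolding J_def by (rule prime_uncertainty)
    moreover have "{i \<in> {..<q}. g \<psi> i \<noteq> 0} \<subseteq> T"
      by (auto simp: T_def g_def supp_def fourier_def intro!: sum.neutral)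
    ultimately show ?thesis using card_mono[OF finT, of "{i \<in> {..<q}. g \<psi> i \<noteq> 0}"] by linarith
  qed
  define E where "E = (\<lambda>(\<psi>, j). extension (z' \<psi> j) \<psi>)"
  have "inj_on E (Sigma \<Psi> J)"
  proof (rule inj_onI, clarify)
    fix \<psi> j \<psi>' j' assume *: "\<psi> \<in> \<Psi>" "j \<in> J \<psi>" "\<psi>' \<in> \<Psi>" "j' \<in> J \<psi>'" "E (\<psi>, j) = E (\<psi>', j')"
    then have eq: "extension (z' \<psi> j) \<psi> = extension (z' \<psi>' j') \<psi>'" by (simp add: E_def)
    note inj = extension_inj[OF \<Psi>(1)[OF *(1)] z'_pow[OF *(1)] \<Psi>(1)[OF *(3)] z'_pow[OF *(3)] eq]
    have "\<psi> = \<psi>'" by (rule inj(1))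
    moreover have "z' \<psi> j = z' \<psi>' j'" by (rule inj(2))
    ultimately have "inverse w ^ j = inverse w ^ j'"
      using z_nonzero[OF \<Psi>(2)[OF *(1)] z[OF *(1)]] by (simp add: z'_def)
    then have "w ^ j = w ^ j'" by (simp add: power_inverse)
    then have "j = j'" using inj_on_power_root_of_unity[OF w q] * by (auto simp: J_def dest: inj_onD)
    with \<open>\<psi> = \<psi>'\<close> show "\<psi> = \<psi>' \<and> j = j'" by simp
  qed
  moreover have "E ` Sigma \<Psi> J \<subseteq> supp (character_group G) (fourier G f)"
  proof clarify
    fix \<psi> j assume "\<psi> \<in> \<Psi>" "j \<in> J \<psi>"
    then show "E (\<psi>, j) \<in> supp (character_group G) (fourier G f)"
      using extension_character[OF \<Psi>(2)[of \<psi>] z'_pow[of \<psi> j]]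
      by (simp add: E_def supp_def fourier J_def)
  qed
  moreover have "finite (supp (character_group G) (fourier G f))"
    using finite_character_group[OF fin] by (simp add: supp_def)
  ultimately have "card (Sigma \<Psi> J) \<le> card (supp (character_group G) (fourier G f))"
    by (intro card_inj_on_le)
  moreover have "card (Sigma \<Psi> J) = (\<Sum>\<psi>\<in>\<Psi>. card (J \<psi>))"
    using fin\<Psi> by (intro card_SigmaI) (auto simp: J_def)
  moreover have "card \<Psi> * (q + 1 - card T) \<le> (\<Sum>\<psi>\<in>\<Psi>. card (J \<psi>))"
    using sum_bounded_below[of \<Psi> "q + 1 - card T" "\<lambda>\<psi>. card (J \<psi>)"] card_J by simp
  ultimately show ?thesis by (simp add: \<Psi>_def T_def)
qed

lemma (in prime_index_subgroup) card_supp_eq: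
  assumes fin: "finite (carrier G)"
  shows "card (supp G f) = (\<Sum>i<q. card (supp H_group (\<lambda>h. f (b [^] i \<otimes> h))))"
proof -
  have finH: "finite H" using fin finite_subset[OF subset] by blast
  have card_eq: "card {x \<in> A. P x} = (\<Sum>x\<in>A. if P x then 1 else 0)" if "finite A" for A :: "'a set" and P
    using that by (simp add: sum.If_cases Int_def)
  have "card (supp G f) = (\<Sum>x\<in>carrier G. if f x \<noteq> 0 then 1 else 0)"
    unfolding supp_def by (rule card_eq[OF fin])
  also have "\<dots> = (\<Sum>i<q. \<Sum>h\<in>H. if f (b [^] i \<otimes> h) \<noteq> 0 then 1 else 0)"
    by (rule sum_carrier)
  also have "\<dots> = (\<Sum>i<q. card {h \<in> H. f (b [^] i \<otimes> h) \<noteq> 0})"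
    by (simp only: card_eq[OF finH])
  finally show ?thesis by (simp add: supp_def)
qed

text \<open>Strong induction on the order with \<open>G\<close> generalised: \<open>H_group\<close>
  lives on the same type, so the induction hypothesis applies to it.\<close>

theorem meshulam_uncertainty:
  fixes G :: "('a, 'b) monoid_scheme" and f :: "'a \<Rightarrow> complex"
  assumes "comm_group G" and "finite (carrier G)" and "supp G f \<noteq> {}"
  shows "meshulam_bound (order G) (card (supp G f))
    \<le> card (supp (character_group G) (fourier G f))"
  using assms
proof (induction "order G" arbitrary: G f rule: less_induct)
  case less
  interpret comm_group G by (rule less.prems(1))
  have fin: "finite (carrier G)" by (rule less.prems(2))
  have k: "1 \<le> card (supp G f)" "card (supp G f) \<le> order G"
    using less.prems fin card_mono[OF fin, of "supp G f"]
    by (auto simp: supp_def order_def Suc_le_eq card_gt_0_iff)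
  show ?case
  proof (cases "order G = 1")
    case True
    then obtain a where "carrier G = {a}" unfolding order_def by (rule card_1_singletonE)
    then have carrier: "carrier G = {\<one>\<^bsub>G\<^esub>}" using one_closed by simp
    let ?\<chi> = "\<lambda>x\<in>carrier G. 1 :: complex"
    have "?\<chi> \<in> supp (character_group G) (fourier G f)"
      using less.prems(3) carrier by (auto simp: supp_def character_group_def fourier_def hom_def complex_mult_group_def)
    moreover have "finite (supp (character_group G) (fourier G f))"
      using finite_character_group[OF fin] by (simp add: supp_def)
    ultimately have "1 \<le> card (supp (character_group G) (fourier G f))"
      by (auto simp: Suc_le_eq card_gt_0_iff)
    \<comment> \<open>In the trivial group the support has exactly one point.\<close>
    moreover have "meshulam_bound 1 1 \<le> 1"
      using meshulam_bound_le_chord[of 1 1 1] by (simp add: chord_def)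
    ultimately show ?thesis using k True by simp
  next
    case False
    then obtain H b q where "prime_index_subgroup H G b q"
      using obtains_prime_index_subgroup[OF fin] by blast
    then interpret prime_index_subgroup H G b q .
    define f' where "f' i = (\<lambda>h. f (b [^]\<^bsub>G\<^esub> (i::nat) \<otimes>\<^bsub>G\<^esub> h))" for i
    define T where "T = {i \<in> {..<q}. supp H_group (f' i) \<noteq> {}}"
    define size where "size i = card (supp H_group (f' i))" for i
    have finH: "finite H" using fin finite_subset[OF subset] by blast
    have T: "finite T" "card T \<le> q"
      using card_mono[of "{..<q}" T] by (auto simp: T_def)
    have "card (supp G f) = (\<Sum>i<q. size i)"
      unfolding card_supp_eq[OF fin] by (simp add: size_def f'_def)
    also have "\<dots> = (\<Sum>i\<in>T. size i)"
      by (rule sum.mono_neutral_right) (auto simp: T_def size_def)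
    finally have card_supp: "card (supp G f) = (\<Sum>i\<in>T. size i)" .
    then have "T \<noteq> {}" using k by auto
    \<comment> \<open>The coset with the smallest nonempty part of the support, so that
      \<open>size i0 * card T\<close> does not exceed the size of the whole support.\<close>
    then obtain i0 where i0: "i0 \<in> T" "\<And>i. i \<in> T \<Longrightarrow> size i0 \<le> size i"
      using ex_is_arg_min_if_finite[OF T(1), of size] by (auto simp: is_arg_min_linorder)
    have finite_supp: "finite (supp H_group (f' i0))" using finH by (simp add: supp_def)
    then have size: "1 \<le> size i0" "size i0 \<le> card H"
      using i0(1) card_mono[OF finH, of "supp H_group (f' i0)"]
      by (auto simp: T_def size_def Suc_le_eq card_gt_0_iff supp_def)
    have t: "1 \<le> card T" using T \<open>T \<noteq> {}\<close> by (simp add: Suc_le_eq card_gt_0_iff)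
    have st: "size i0 * card T \<le> card (supp G f)"
      unfolding card_supp using sum_bounded_below[of T "size i0" size] i0 by (simp add: mult.commute)
    let ?N = "card (supp (character_group H_group) (fourier H_group (f' i0)))"
    have IH: "meshulam_bound (card H) (size i0) \<le> ?N"
      using less.hyps[of H_group "f' i0"] card_H_less[OF fin] H_group finH i0(1)
      by (simp add: order_def size_def T_def)
    have "meshulam_bound (order G) (card (supp G f)) \<le> meshulam_bound (order G) (size i0 * card T)"
      using size t st k by (intro meshulam_bound_antimono) auto
    also have "\<dots> \<le> meshulam_bound (card H) (size i0) * (real q + 1 - real (card T))"
      unfolding order_eq by (rule meshulam_bound_mult_prime[OF q size t T(2)])
    also have "\<dots> \<le> real ?N * (real q + 1 - real (card T))"
      using IH T by (intro mult_right_mono) auto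
    also have "\<dots> = real (?N * (q + 1 - card T))" using T by (simp add: of_nat_diff)
    also have "\<dots> \<le> card (supp (character_group G) (fourier G f))"
      unfolding of_nat_le_iff T_def f'_def
      using i0(1) by (intro card_supp_fourier_ge[OF fin]) (simp add: T_def)
    finally show ?thesis .
  qed
qed

theorem theorem1p2:
  fixes G :: "('a, 'b) monoid_scheme" (structure)
    and f :: "'a \<Rightarrow> complex"
    and n k d1 d2 :: nat
  assumes "comm_group G" and "finite (carrier G)" and "order G = n"
    and "card (supp G f) = k" and "k \<noteq> 0"
    and "d1 = Max {d. d dvd n \<and> d \<le> k}"
    and "d2 = Min {d. d dvd n \<and> k \<le> d}"
  shows "real (card (supp (character_group G) (fourier G f)))
    \<ge> real n / (real d1 * real d2) * (real d1 + real d2 - real k)"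
proof -
  have "supp G f \<noteq> {}" using assms(4,5) by auto
  from meshulam_uncertainty[OF assms(1,2) this]
  show ?thesis
    using assms by (simp add: meshulam_bound_def chord_def lower_divisor_def upper_divisor_def)
qed

end
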